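(* Let $X$ and $Y$ be real locally convex Hausdorff topological vector spaces with topological duals $X^{\ast}$ and $Y^{\ast}$, $U$ an uncertainty (index) set, $F_{u}\colon X\times Y\to\overline{\mathbb{R}}=\mathbb{R}\cup\{\pm\infty\}$, $u\in U$, a family of functions, and $h\colon X\to\overline{\mathbb{R}}$ a proper convex lower semicontinuous function. Let $$\mathcal{F}^{\#}:=\left\{(x',s)\in X^{\ast}\times\mathbb{R}:\exists(u,\mu)\in U\times Y^{\ast},\ (F_{u})^{\ast}(x',\mu)\leq s\right\}.$$ Assume that for every $a'\in\operatorname{dom}h^{\ast}$, $$\inf_{x\in X}\left(\sup_{u\in U}F_{u}(x,0_{Y})-\langle a',x\rangle\right)=\inf_{x\in X}\left(\sup_{u\in U}(F_{u})^{\ast\ast}(x,0_{Y})-\langle a',x\rangle\right)\neq+\infty,$$ and that $\mathcal{F}^{\#}$ is weak*-closed convex regarding $\operatorname{gph}h^{\ast}$. Then the robust $S^{h}_{\{F_{u}\}_{u\in U}}$-procedure is valid.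
   Context: $X^{\ast}$ and $X^{\ast}\times\mathbb{R}$ carry the weak*-topology; $\langle\cdot,\cdot\rangle$ denotes the duality products; $0_{Y}$ is the null vector of $Y$. Fenchel conjugates: $h^{\ast}(a')=\sup_{x\in X}\{\langle a',x\rangle-h(x)\}$, $\operatorname{dom}h^{\ast}=\{a'\in X^{\ast}:h^{\ast}(a')<+\infty\}$, $\operatorname{gph}h^{\ast}=\{(a',h^{\ast}(a')):a'\in\operatorname{dom}h^{\ast}\}$. For $F\colon X\times Y\to\overline{\mathbb{R}}$, $F^{\ast}(x',\mu)=\sup_{(x,y)\in X\times Y}\{\langle x',x\rangle+\langle\mu,y\rangle-F(x,y)\}$ for $(x',\mu)\in X^{\ast}\times Y^{\ast}$, and $F^{\ast\ast}(x,y)=\sup_{(x',\mu)\in X^{\ast}\times Y^{\ast}}\{\langle x',x\rangle+\langle\mu,y\rangle-F^{\ast}(x',\mu)\}$ for $(x,y)\in X\times Y$. The robust $S^{h}_{\{F_{u}\}_{u\in U}}$-procedure (with right-hand side function $h$) concerns the two statements $(\mathfrak{A}_{h})$: $\sup_{u\in U}F_{u}(x,0_{Y})\geq h(x)$ for all $x\in X$; $(\mathfrak{B}_{h})$: for every $a'\in\operatorname{dom}h^{\ast}$ there exists $(\bar u,\bar\mu)\in U\times Y^{\ast}$ such that $(F_{\bar u})^{\ast}(a',\bar\mu)\leq h^{\ast}(a')$. One always has $(\mathfrak{B}_{h})\Rightarrow(\mathfrak{A}_{h})$. The procedure is said to be valid if $(\mathfrak{A}_{h})\Leftrightarrow(\mathfrak{B}_{h})$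 or, equivalently, $(\mathfrak{A}_{h})\Rightarrow(\mathfrak{B}_{h})$. A subset $C$ of a locally convex space is closed convex regarding a subset $D$ of the same space if $(\overline{\operatorname{co}}\,C)\cap D=C\cap D$, where $\overline{\operatorname{co}}\,C$ is the closure of the convex hull of $C$; "weak*-closed convex regarding" means that the closure is taken in the weak*-topology. *)

theory Defs
  imports "HOL-Analysis.Analysis"
begin

class locally_convex_space = real_vector + topological_ab_group_add + t2_space +
  assumes tendsto_scaleR_Pair:
    "LIM p (nhds a \<times>\<^sub>F nhds x). fst p *\<^sub>R snd p :> nhds (a *\<^sub>R x)"
  assumes convex_nhds_base: \<comment> \<open>\<^const>\<open>convex\<close> is unfolded, as it cannot be used in a class specification\<close>
    "open S \<Longrightarrow> x \<in> S \<Longrightarrow> \<exists>V. open V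
      \<and> (\<forall>v\<in>V. \<forall>w\<in>V. \<forall>a\<ge>0. \<forall>b\<ge>0. a + b = 1 \<longrightarrow> a *\<^sub>R v + b *\<^sub>R w \<in> V)
      \<and> x \<in> V \<and> V \<subseteq> S"

lemma locally_convex:
  fixes S :: "'a::locally_convex_space set"
  shows "open S \<Longrightarrow> x \<in> S \<Longrightarrow> \<exists>V. open V \<and> convex V \<and> x \<in> V \<and> V \<subseteq> S"
  unfolding convex_def by (rule convex_nhds_base)

instance real_normed_vector \<subseteq> locally_convex_space
proof
  fix a :: real and x :: 'a
  show "LIM p (nhds a \<times>\<^sub>F nhds x). fst p *\<^sub>R snd p :> nhds (a *\<^sub>R x)"
    by (intro tendsto_scaleR filterlim_fst filterlim_snd)
next
  fix S :: "'a set" and x :: 'a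
  assume "open S" "x \<in> S"
  then obtain e where "e > 0" "ball x e \<subseteq> S"
    using openE by blast
  then have "\<exists>V. open V \<and> convex V \<and> x \<in> V \<and> V \<subseteq> S"
    by (intro exI[of _ "ball x e"]) auto
  then show "\<exists>V. open V
      \<and> (\<forall>v\<in>V. \<forall>w\<in>V. \<forall>a\<ge>0. \<forall>b\<ge>0. a + b = 1 \<longrightarrow> a *\<^sub>R v + b *\<^sub>R w \<in> V)
      \<and> x \<in> V \<and> V \<subseteq> S"
    unfolding convex_def .
qed

instance prod :: (topological_monoid_add, topological_monoid_add) topological_monoid_add
proof
  fix a b :: "'a \<times> 'b"
  have "((\<lambda>p. fst (fst p) + fst (snd p)) \<longlongrightarrow> fst a + fst b) (nhds a \<times>\<^sub>F nhds b)"
       "((\<lambda>p. snd (fst p) + snd (snd p)) \<longlongrightarrow> snd a + snd b) (nhds a \<times>\<^sub>F nhds b)"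
    by (intro tendsto_add tendsto_fst tendsto_snd filterlim_fst filterlim_snd)+
  from tendsto_Pair[OF this]
  show "LIM p (nhds a \<times>\<^sub>F nhds b). fst p + snd p :> nhds (a + b)"
    by (simp add: plus_prod_def)
qed

instance prod :: (topological_comm_monoid_add, topological_comm_monoid_add)
  topological_comm_monoid_add ..

instance prod :: (topological_group_add, topological_group_add) topological_group_add
proof
  fix a :: "'a \<times> 'b"
  have "((\<lambda>p. - fst p) \<longlongrightarrow> - fst a) (nhds a)" "((\<lambda>p. - snd p) \<longlongrightarrow> - snd a) (nhds a)"
    by (intro tendsto_minus tendsto_fst tendsto_snd tendsto_ident_at filterlim_ident)+
  from tendsto_Pair[OF this] show "(uminus \<longlongrightarrow> - a) (nhds a)"
    by (simp add: uminus_prod_def[abs_def])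
qed

instance prod :: (topological_ab_group_add, topological_ab_group_add) topological_ab_group_add ..

instance prod :: (locally_convex_space, locally_convex_space) locally_convex_space
proof
  fix a :: real and x :: "'a \<times> 'b"
  have fs: "(fst \<longlongrightarrow> fst x) (nhds x)" "(snd \<longlongrightarrow> snd x) (nhds x)"
    by (intro tendsto_fst tendsto_snd filterlim_ident)+
  have 1: "LIM p (nhds a \<times>\<^sub>F nhds x). fst p *\<^sub>R fst (snd p) :> nhds (a *\<^sub>R fst x)"
    using filterlim_compose[OF tendsto_scaleR_Pair
        filterlim_Pair[OF filterlim_fst filterlim_compose[OF fs(1) filterlim_snd]]]
    by simp
  have 2: "LIM p (nhds a \<times>\<^sub>F nhds x). fst p *\<^sub>R snd (snd p) :> nhds (a *\<^sub>R snd x)"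
    using filterlim_compose[OF tendsto_scaleR_Pair
        filterlim_Pair[OF filterlim_fst filterlim_compose[OF fs(2) filterlim_snd]]]
    by simp
  from tendsto_Pair[OF 1 2]
  show "LIM p (nhds a \<times>\<^sub>F nhds x). fst p *\<^sub>R snd p :> nhds (a *\<^sub>R x)"
    by (simp add: scaleR_prod_def)
next
  fix S :: "('a \<times> 'b) set" and x :: "'a \<times> 'b"
  assume "open S" "x \<in> S"
  then obtain A B where "open A" "open B" "x \<in> A \<times> B" "A \<times> B \<subseteq> S"
    by (rule open_prod_elim)
  moreover from this obtain V where "open V" "convex V" "fst x \<in> V" "V \<subseteq> A"
    using locally_convex[of A "fst x"] by auto
  moreover from calculation obtain W where "open W" "convex W" "snd x \<in> W" "W \<subseteq> B"
    using locally_convex[of B "snd x"] by auto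
  ultimately have "\<exists>V. open V \<and> convex V \<and> x \<in> V \<and> V \<subseteq> S"
    by (intro exI[of _ "V \<times> W"]) (auto simp: open_Times convex_Times mem_Times_iff)
  then show "\<exists>V. open V
      \<and> (\<forall>v\<in>V. \<forall>w\<in>V. \<forall>a\<ge>0. \<forall>b\<ge>0. a + b = 1 \<longrightarrow> a *\<^sub>R v + b *\<^sub>R w \<in> V)
      \<and> x \<in> V \<and> V \<subseteq> S"
    unfolding convex_def .
qed

typedef (overloaded) ('a::locally_convex_space) dual =
  "{f :: 'a \<Rightarrow> real. linear f \<and> continuous_on UNIV f}"
  morphisms pairing Dual
  by (rule exI[of _ "\<lambda>_. 0"]) (auto simp: linear_iff)

setup_lifting type_definition_dual

instantiation dual :: (locally_convex_space) real_vector
begin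

lift_definition zero_dual :: "'a dual" is "\<lambda>_. 0"
  by (auto simp: linear_iff)

lift_definition plus_dual :: "'a dual \<Rightarrow> 'a dual \<Rightarrow> 'a dual" is "\<lambda>f g x. f x + g x"
  by (auto simp: linear_iff algebra_simps intro: continuous_on_add)

lift_definition minus_dual :: "'a dual \<Rightarrow> 'a dual \<Rightarrow> 'a dual" is "\<lambda>f g x. f x - g x"
  by (auto simp: linear_iff algebra_simps intro: continuous_on_diff)

lift_definition uminus_dual :: "'a dual \<Rightarrow> 'a dual" is "\<lambda>f x. - f x"
  by (auto simp: linear_iff intro: continuous_on_minus)

lift_definition scaleR_dual :: "real \<Rightarrow> 'a dual \<Rightarrow> 'a dual" is "\<lambda>c f x. c * f x"
  by (auto simp: linear_iff algebra_simps intro: continuous_on_mult_left)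

instance
  by standard (transfer; simp add: fun_eq_iff algebra_simps)+

end

text \<open>
  The weak* topology: the topology of pointwise convergence, induced by the embedding into
  the function space, whose \<^const>\<open>open\<close> sets are those of the product topology.
\<close>

instantiation dual :: (locally_convex_space) topological_space
begin

definition open_dual_def:
  "open (S :: 'a dual set) \<longleftrightarrow> (\<exists>T. open T \<and> S = pairing -` T)"

instance
proof
  show "open (UNIV :: 'a dual set)"
    unfolding open_dual_def by (intro exI[of _ UNIV]) auto
next
  fix S T :: "'a dual set"
  assume "open S" "open T"
  then show "open (S \<inter> T)"
    unfolding open_dual_def by (metis open_Int vimage_Int)
next
  fix K :: "'a dual set set"
  assume "\<forall>S\<in>K. open S"
  then obtain g where "\<forall>S\<in>K. open (g S) \<and> S = pairing -` g S"
    unfolding open_dual_def by metis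
  then have "open (\<Union> (g ` K))" "\<Union> K = pairing -` \<Union> (g ` K)"
    by auto
  then show "open (\<Union> K)"
    unfolding open_dual_def by blast
qed

end

lemma tendsto_dual_iff:
  "(f \<longlongrightarrow> l) F \<longleftrightarrow> (\<forall>x. ((\<lambda>i. pairing (f i) x) \<longlongrightarrow> pairing l x) F)"
proof
  assume L: "(f \<longlongrightarrow> l) F"
  show "\<forall>x. ((\<lambda>i. pairing (f i) x) \<longlongrightarrow> pairing l x) F"
  proof (intro allI topological_tendstoI)
    fix x and S :: "real set"
    assume S: "open S" "pairing l x \<in> S"
    have "open {p :: 'b \<Rightarrow> real. \<forall>i\<in>{()}. p x \<in> S}"
      using S by (intro product_topology_basis') auto
    then have "open (pairing -` {p. p x \<in> S})"
      unfolding open_dual_def by auto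
    from topological_tendstoD[OF L this] S show "\<forall>\<^sub>F i in F. pairing (f i) x \<in> S"
      by auto
  qed
next
  assume R: "\<forall>x. ((\<lambda>i. pairing (f i) x) \<longlongrightarrow> pairing l x) F"
  show "(f \<longlongrightarrow> l) F"
  proof (rule topological_tendstoI)
    fix S :: "'b dual set"
    assume "open S" "l \<in> S"
    then obtain T where T: "open T" "S = pairing -` T" "pairing l \<in> T"
      unfolding open_dual_def by auto
    then obtain X where X: "pairing l \<in> Pi\<^sub>E UNIV X" "\<And>i. open (X i)"
        "finite {i. X i \<noteq> UNIV}" "Pi\<^sub>E UNIV X \<subseteq> T"
      unfolding open_fun_def using product_topology_open_contains_basis[of "\<lambda>_. euclidean" UNIV T "pairing l"]
      by auto
    have "\<forall>\<^sub>F j in F. \<forall>i\<in>{i. X i \<noteq> UNIV}. pairing (f j) i \<in> X i"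
      using R X by (intro eventually_ball_finite[OF X(3)] ballI topological_tendstoD) auto
    then show "\<forall>\<^sub>F j in F. f j \<in> S"
    proof eventually_elim
      case (elim j)
      then have "pairing (f j) \<in> Pi\<^sub>E UNIV X" by (fastforce simp: PiE_iff)
      then show ?case using T X by auto
    qed
  qed
qed

lemmas tendsto_pairing = tendsto_dual_iff[THEN iffD1, rule_format]

instance dual :: (locally_convex_space) locally_convex_space
proof
  fix a b :: "'a dual"
  have "((\<lambda>p. pairing (fst p) x) \<longlongrightarrow> pairing a x) (nhds a \<times>\<^sub>F nhds b)"
       "((\<lambda>p. pairing (snd p) x) \<longlongrightarrow> pairing b x) (nhds a \<times>\<^sub>F nhds b)" for x
    by (intro tendsto_pairing filterlim_fst filterlim_snd)+
  then show "LIM x (nhds a \<times>\<^sub>F nhds b). fst x + snd x :> nhds (a + b)"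
    by (auto simp: tendsto_dual_iff plus_dual.rep_eq intro: tendsto_add)
next
  fix a :: "'a dual"
  show "(uminus \<longlongrightarrow> - a) (nhds a)"
    by (auto simp: tendsto_dual_iff uminus_dual.rep_eq
        intro!: tendsto_minus tendsto_pairing filterlim_ident)
next
  fix a b :: "'a dual"
  assume "a \<noteq> b"
  then obtain x where "pairing a x \<noteq> pairing b x"
    by (metis pairing_inject ext)
  then obtain S T where ST: "open S" "open T" "pairing a x \<in> S" "pairing b x \<in> T" "S \<inter> T = {}"
    using hausdorff by meson
  have "open ((\<lambda>f. pairing f x) -` V)" if "open V" for V
    using that tendsto_pairing[of "\<lambda>f. f" _ "at _" x, OF tendsto_ident_at]
    by (intro open_vimage) (auto simp: continuous_on_def)
  with ST show "\<exists>U V. open U \<and> open V \<and> a \<in> U \<and> b \<in> V \<and> U \<inter> V = {}"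
    by (intro exI[of _ "(\<lambda>f. pairing f x) -` S"] exI[of _ "(\<lambda>f. pairing f x) -` T"]) auto
next
  fix c :: real and a :: "'a dual"
  have "((\<lambda>p. pairing (snd p) x) \<longlongrightarrow> pairing a x) (nhds c \<times>\<^sub>F nhds a)" for x
    by (intro tendsto_pairing filterlim_snd)
  then show "LIM p (nhds c \<times>\<^sub>F nhds a). fst p *\<^sub>R snd p :> nhds (c *\<^sub>R a)"
    by (auto simp: tendsto_dual_iff scaleR_dual.rep_eq intro: tendsto_mult filterlim_fst)
next
  fix S :: "'a dual set" and l
  assume "open S" "l \<in> S"
  then obtain T where T: "open T" "S = pairing -` T" "pairing l \<in> T"
    unfolding open_dual_def by auto
  then obtain X where X: "pairing l \<in> Pi\<^sub>E UNIV X" "\<And>i. open (X i)"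
      "finite {i. X i \<noteq> UNIV}" "Pi\<^sub>E UNIV X \<subseteq> T"
    unfolding open_fun_def using product_topology_open_contains_basis[of "\<lambda>_. euclidean" UNIV T "pairing l"]
    by auto
  have "\<exists>Y. open Y \<and> convex Y \<and> pairing l i \<in> Y \<and> Y \<subseteq> X i \<and> (X i = UNIV \<longrightarrow> Y = UNIV)" for i
    using X locally_convex[of "X i" "pairing l i"] by (cases "X i = UNIV") (auto simp: PiE_iff)
  then obtain Y where Y: "\<And>i. open (Y i)" "\<And>i. convex (Y i)" "\<And>i. pairing l i \<in> Y i"
      "\<And>i. Y i \<subseteq> X i" "\<And>i. X i = UNIV \<Longrightarrow> Y i = UNIV"
    by metis
  have "finite {i. Y i \<noteq> UNIV}"
    using X(3) by (rule rev_finite_subset) (use Y(5) in auto)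
  then have "open (Pi\<^sub>E UNIV Y)"
    using Y(1) by (intro open_PiE)
  moreover have "convex (pairing -` Pi\<^sub>E UNIV Y)"
    using Y(2) by (auto simp: convex_def PiE_iff plus_dual.rep_eq scaleR_dual.rep_eq)
  moreover have "pairing -` Pi\<^sub>E UNIV Y \<subseteq> S"
    using Y(4) X(4) T(2) by (fastforce simp: PiE_iff)
  ultimately have "\<exists>V. open V \<and> convex V \<and> l \<in> V \<and> V \<subseteq> S"
    using Y(3) by (intro exI[of _ "pairing -` Pi\<^sub>E UNIV Y"]) (auto simp: open_dual_def PiE_iff)
  then show "\<exists>V. open V
      \<and> (\<forall>v\<in>V. \<forall>w\<in>V. \<forall>a\<ge>0. \<forall>b\<ge>0. a + b = 1 \<longrightarrow> a *\<^sub>R v + b *\<^sub>R w \<in> V)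
      \<and> l \<in> V \<and> V \<subseteq> S"
    unfolding convex_def .
qed

definition proper_fun :: "('a \<Rightarrow> ereal) \<Rightarrow> bool" where
  "proper_fun h \<longleftrightarrow> (\<forall>x. h x \<noteq> -\<infinity>) \<and> (\<exists>x. h x \<noteq> \<infinity>)"

definition convex_fun :: "('a::real_vector \<Rightarrow> ereal) \<Rightarrow> bool" where
  "convex_fun h \<longleftrightarrow> convex {(x, r :: real). h x \<le> ereal r}"

definition lsc_fun :: "('a::topological_space \<Rightarrow> ereal) \<Rightarrow> bool" where
  "lsc_fun h \<longleftrightarrow> (\<forall>x. \<forall>c < h x. \<forall>\<^sub>F y in nhds x. c < h y)"

text \<open>
  In the conjugates below one operand of each subtraction is a real number, so the library's
  convention for \<open>\<infinity> - \<infinity>\<close> is never used.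
\<close>

definition conjugate :: "('a::locally_convex_space \<Rightarrow> ereal) \<Rightarrow> 'a dual \<Rightarrow> ereal" where
  "conjugate h a = (SUP x. ereal (pairing a x) - h x)"

definition dom_conjugate :: "('a::locally_convex_space \<Rightarrow> ereal) \<Rightarrow> 'a dual set" where
  "dom_conjugate h = {a. conjugate h a < \<infinity>}"

text \<open>
  For proper \<open>h\<close>, the conjugate is real-valued on its domain, so the following is its graph as a
  subset of \<open>X\<^sup>* \<times> \<real>\<close>.
\<close>

definition gph_conjugate :: "('a::locally_convex_space \<Rightarrow> ereal) \<Rightarrow> ('a dual \<times> real) set" where
  "gph_conjugate h = {(a, s). a \<in> dom_conjugate h \<and> ereal s = conjugate h a}"

definition conjugate2 ::
  "('a::locally_convex_space \<times> 'b::locally_convex_space \<Rightarrow> ereal) \<Rightarrow> 'a dual \<times> 'b dual \<Rightarrow> ereal"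
  where "conjugate2 F = (\<lambda>(a, \<mu>). SUP (x, y). ereal (pairing a x + pairing \<mu> y) - F (x, y))"

definition biconjugate2 ::
  "('a::locally_convex_space \<times> 'b::locally_convex_space \<Rightarrow> ereal) \<Rightarrow> 'a \<times> 'b \<Rightarrow> ereal"
  where "biconjugate2 F =
    (\<lambda>(x, y). SUP (a, \<mu>). ereal (pairing a x + pairing \<mu> y) - conjugate2 F (a, \<mu>))"

definition closed_convex_regarding :: "'a::locally_convex_space set \<Rightarrow> 'a set \<Rightarrow> bool" where
  "closed_convex_regarding C D \<longleftrightarrow> closure (convex hull C) \<inter> D = C \<inter> D"

definition F_sharp ::
  "'u set \<Rightarrow> ('u \<Rightarrow> 'a::locally_convex_space \<times> 'b::locally_convex_space \<Rightarrow> ereal)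
    \<Rightarrow> ('a dual \<times> real) set" where
  "F_sharp U F = {(a, s). \<exists>u\<in>U. \<exists>\<mu>. conjugate2 (F u) (a, \<mu>) \<le> ereal s}"

definition statement_A ::
  "('a::locally_convex_space \<Rightarrow> ereal) \<Rightarrow> 'u set
    \<Rightarrow> ('u \<Rightarrow> 'a \<times> 'b::locally_convex_space \<Rightarrow> ereal) \<Rightarrow> bool" where
  "statement_A h U F \<longleftrightarrow> (\<forall>x. (SUP u\<in>U. F u (x, 0)) \<ge> h x)"

definition statement_B ::
  "('a::locally_convex_space \<Rightarrow> ereal) \<Rightarrow> 'u set
    \<Rightarrow> ('u \<Rightarrow> 'a \<times> 'b::locally_convex_space \<Rightarrow> ereal) \<Rightarrow> bool" where
  "statement_B h U F \<longleftrightarrow>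
    (\<forall>a\<in>dom_conjugate h. \<exists>u\<in>U. \<exists>\<mu>. conjugate2 (F u) (a, \<mu>) \<le> conjugate h a)"

definition S_procedure_valid ::
  "('a::locally_convex_space \<Rightarrow> ereal) \<Rightarrow> 'u set
    \<Rightarrow> ('u \<Rightarrow> 'a \<times> 'b::locally_convex_space \<Rightarrow> ereal) \<Rightarrow> bool" where
  "S_procedure_valid h U F \<longleftrightarrow> (statement_A h U F \<longleftrightarrow> statement_B h U F)"

end

theory Submission
  imports Defs
begin

text \<open>
  Write \<open>G = sup\<^sub>u F\<^sub>u\<^sup>*\<^sup>*(\<cdot>, 0)\<close>, so that \<open>G y = sup {\<langle>b, y\<rangle> - t | (b, t) \<in> F\<^sup>#}\<close>. Let (A) hold and let
  \<open>s = h\<^sup>*(a)\<close> be finite. By (A) and the equality of the infima, \<open>\<langle>a, \<cdot>\<rangle> - s \<le> G\<close>, and \<open>G\<close> is not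
  identically \<open>\<infinity>\<close>. If \<open>(a, s)\<close> were outside the weak* closed convex hull of \<open>F\<^sup>#\<close>, Hahn--Banach would
  separate the two by some \<open>(x, r) \<in> X \<times> \<real>\<close>, as the weak* continuous functionals are the evaluations.
  Here \<open>r \<ge> 0\<close> since \<open>F\<^sup>#\<close> is closed upwards; if \<open>r > 0\<close>, the minorant fails at \<open>-x/r\<close>, and if
  \<open>r = 0\<close>, it fails far out on a ray in direction \<open>-x\<close>. So \<open>(a, s)\<close> lies in the closed convex hull,
  hence in \<open>F\<^sup>#\<close>, which is (B). The converse is Fenchel--Moreau for \<open>h\<close>.
\<close>

section \<open>Hahn--Banach separation\<close>

text \<open>
  The separating functional is read off a maximal convex cone \<open>P\<close> avoiding \<open>-e\<close>. Maximality makes the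
  preorder \<open>x \<le> y \<longleftrightarrow> y - x \<in> P\<close> total, and \<open>sup {t. t e \<le> x}\<close> is then linear in \<open>x\<close> as soon as \<open>e\<close> is
  an order unit.
\<close>

lemma convex_cone_add_ray:
  assumes "convex_cone P"
  shows "convex_cone {p + t *\<^sub>R x | p t. p \<in> P \<and> 0 \<le> t}" (is "convex_cone ?Q")
  unfolding convex_cone_iff
proof (intro conjI ballI allI impI)
  show "0 \<in> ?Q"
    using convex_cone_contains_0[OF assms] by (auto intro!: exI[of _ 0])
next
  fix y z assume "y \<in> ?Q" "z \<in> ?Q"
  then obtain p s q t where "y = p + s *\<^sub>R x" "z = q + t *\<^sub>R x" "p \<in> P" "q \<in> P" "0 \<le> s" "0 \<le> t"
    by blast
  then have "y + z = (p + q) + (s + t) *\<^sub>R x" "p + q \<in> P" "0 \<le> s + t"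
    using assms by (auto simp: algebra_simps convex_cone_iff)
  then show "y + z \<in> ?Q"
    by blast
next
  fix y and c :: real assume "y \<in> ?Q" "0 \<le> c"
  then obtain p t where "y = p + t *\<^sub>R x" "p \<in> P" "0 \<le> t"
    by blast
  then have "c *\<^sub>R y = c *\<^sub>R p + (c * t) *\<^sub>R x" "c *\<^sub>R p \<in> P" "0 \<le> c * t"
    using assms \<open>0 \<le> c\<close> by (auto simp: algebra_simps convex_cone_iff)
  then show "c *\<^sub>R y \<in> ?Q"
    by blast
qed

text \<open>Zorn's lemma gives a maximal cone \<open>P\<close>. If it contained neither
  \<open>x\<close> nor \<open>- x\<close>, adjoining either ray would force \<open>- e\<close> into
  the larger cone, and combining the two representations of \<open>- e\<close> puts
  \<open>- e\<close> into \<open>P\<close> itself.\<close>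

lemma total_convex_cone_extension:
  fixes K :: "'a::real_vector set"
  assumes "convex_cone K" and "- e \<notin> K"
  obtains P where "convex_cone P" "K \<subseteq> P" "- e \<notin> P" "\<And>x. x \<in> P \<or> - x \<in> P"
proof -
  define \<P> where "\<P> = {P. convex_cone P \<and> K \<subseteq> P \<and> - e \<notin> P}"
  have "\<exists>P\<in>\<P>. \<forall>X\<in>\<P>. P \<subseteq> X \<longrightarrow> X = P"
  proof (rule subset_Zorn_nonempty)
    show "\<P> \<noteq> {}"
      using assms by (auto simp: \<P>_def)
  next
    fix C assume C: "C \<noteq> {}" "subset.chain \<P> C"
    then have C_sub: "\<And>P. P \<in> C \<Longrightarrow> convex_cone P \<and> K \<subseteq> P \<and> - e \<notin> P"
      by (auto simp: subset.chain_def \<P>_def)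
    have "x + y \<in> \<Union>C" if xy: "x \<in> \<Union>C" "y \<in> \<Union>C" for x y
    proof -
      obtain P Q where PQ: "P \<in> C" "Q \<in> C" "x \<in> P" "y \<in> Q"
        using xy by blast
      then have "P \<subseteq> Q \<or> Q \<subseteq> P"
        using C(2) by (auto simp: subset_chain_def)
      then have "x + y \<in> P \<or> x + y \<in> Q"
        using C_sub PQ unfolding convex_cone_iff by blast
      then show ?thesis
        using PQ by blast
    qed
    moreover have "c *\<^sub>R x \<in> \<Union>C" if "x \<in> \<Union>C" "0 \<le> c" for x c
      using C_sub that unfolding convex_cone_iff by blast
    moreover obtain P where "P \<in> C"
      using C(1) by blast
    moreover have "0 \<in> P" "K \<subseteq> P"
      using C_sub[OF \<open>P \<in> C\<close>] unfolding convex_cone_iff by blast+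
    ultimately show "\<Union>C \<in> \<P>"
      using C_sub unfolding \<P>_def convex_cone_iff by blast
  qed
  then obtain P where P: "P \<in> \<P>" and P_max: "\<And>X. X \<in> \<P> \<Longrightarrow> P \<subseteq> X \<Longrightarrow> X = P"
    by blast
  have cone: "convex_cone P" and "K \<subseteq> P" and "- e \<notin> P"
    using P by (auto simp: \<P>_def)
  \<comment> \<open>By maximality, the cone generated by \<open>P\<close> and \<open>x\<close> must
    contain \<open>- e\<close>; the coefficient of \<open>x\<close> is nonzero because
    \<open>P\<close> avoids \<open>- e\<close>.\<close>
  have add_ray: "\<exists>p\<in>P. \<exists>t>0. - e = p + t *\<^sub>R x" if "x \<notin> P" for x
  proof -
    define Q where "Q = {p + t *\<^sub>R x | p t. p \<in> P \<and> 0 \<le> t}"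
    have "0 \<in> P"
      using cone convex_cone_contains_0 by blast
    then have "0 + 1 *\<^sub>R x \<in> Q"
      unfolding Q_def using zero_le_one by blast
    then have "x \<in> Q"
      by simp
    have "p + 0 *\<^sub>R x \<in> Q" if "p \<in> P" for p
      unfolding Q_def using that by blast
    then have "P \<subseteq> Q"
      by auto
    have "convex_cone Q"
      unfolding Q_def using cone by (rule convex_cone_add_ray)
    moreover have "Q \<noteq> P"
      using \<open>x \<in> Q\<close> that by blast
    ultimately have "- e \<in> Q"
      using P_max[of Q] \<open>P \<subseteq> Q\<close> \<open>K \<subseteq> P\<close> by (auto simp: \<P>_def)
    then obtain p t where "- e = p + t *\<^sub>R x" "p \<in> P" "0 \<le> t"
      unfolding Q_def by blast
    moreover have "t \<noteq> 0"
      using calculation \<open>- e \<notin> P\<close> by auto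
    ultimately show ?thesis
      by (metis order_le_less)
  qed
  have "x \<in> P \<or> - x \<in> P" for x
  proof (rule ccontr)
    assume "\<not> ?thesis"
    then obtain p s q t where
        "p \<in> P" "s > 0" and p: "- e = p + s *\<^sub>R x" and "q \<in> P" "t > 0" and q: "- e = q + t *\<^sub>R - x"
      using add_ray by meson
    \<comment> \<open>The crossed weights \<open>s\<close> and \<open>t\<close> make the multiples
      of \<open>x\<close> cancel.\<close>
    have "(s + t) *\<^sub>R - e = s *\<^sub>R (q + t *\<^sub>R - x) + t *\<^sub>R (p + s *\<^sub>R x)"
      using p q by (metis scaleR_left_distrib)
    also have "\<dots> = s *\<^sub>R q + t *\<^sub>R p"
      by (simp add: algebra_simps)
    also have "\<dots> \<in> P"
      using cone \<open>p \<in> P\<close> \<open>q \<in> P\<close> \<open>s > 0\<close> \<open>t > 0\<close> by (simp add: convex_cone_iff)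
    finally have "(1 / (s + t)) *\<^sub>R ((s + t) *\<^sub>R - e) \<in> P"
      by (rule convex_cone_scaleR[OF cone, rotated]) (use \<open>s > 0\<close> \<open>t > 0\<close> in simp)
    then show False
      using \<open>- e \<notin> P\<close> \<open>s > 0\<close> \<open>t > 0\<close> by simp
  qed
  with cone \<open>K \<subseteq> P\<close> \<open>- e \<notin> P\<close> that show thesis
    by blast
qed

text \<open>The order unit makes each \<open>T x\<close> nonempty and bounded above, so the supremum
  is a real number. Closure of \<open>P\<close> under addition gives superadditivity; totality
  supplies the reverse inequality through \<open>f_minus_ge\<close>.\<close>

lemma total_convex_cone_functional:
  fixes P :: "'a::real_vector set"
  assumes cone: "convex_cone P" and "- e \<notin> P" and total: "\<And>x. x \<in> P \<or> - x \<in> P"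
    and order_unit: "\<And>x. \<exists>t. x + t *\<^sub>R e \<in> P"
  obtains f :: "'a \<Rightarrow> real" where "linear f" "f e = 1" "\<And>x. x \<in> P \<Longrightarrow> 0 \<le> f x"
proof -
  have add: "x + y \<in> P" if "x \<in> P" "y \<in> P" for x y
    using cone that by (auto simp: convex_cone_iff)
  have scale: "c *\<^sub>R x \<in> P" if "x \<in> P" "0 \<le> c" for x c
    using cone that by (auto simp: convex_cone_iff)
  have e_multiple: "c *\<^sub>R e \<in> P \<longleftrightarrow> 0 \<le> c" for c
  proof
    assume "c *\<^sub>R e \<in> P"
    show "0 \<le> c"
    proof (rule ccontr)
      assume "\<not> 0 \<le> c"
      then have "(- 1 / c) *\<^sub>R (c *\<^sub>R e) \<in> P"
        using scale[OF \<open>c *\<^sub>R e \<in> P\<close>, of "- 1 / c"] by (simp add: divide_nonneg_neg)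
      then show False
        using \<open>\<not> 0 \<le> c\<close> \<open>- e \<notin> P\<close> by simp
    qed
  next
    have "e \<in> P"
      using total[of e] \<open>- e \<notin> P\<close> by blast
    then show "0 \<le> c \<Longrightarrow> c *\<^sub>R e \<in> P"
      by (rule scale)
  qed
  define T where "T x = {t. x - t *\<^sub>R e \<in> P}" for x
  define f where "f x = Sup (T x)" for x
  have T_nonempty: "T x \<noteq> {}" for x
    using order_unit[of x] by (auto simp: T_def intro: exI[of _ "- _"])
  have T_bdd: "bdd_above (T x)" for x
  proof -
    obtain t where t: "- x + t *\<^sub>R e \<in> P"
      using order_unit by blast
    have "s \<le> t" if "s \<in> T x" for s
    proof -
      have "(x - s *\<^sub>R e) + (- x + t *\<^sub>R e) \<in> P"
        using that t unfolding T_def mem_Collect_eq by (rule add)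
      moreover have "(x - s *\<^sub>R e) + (- x + t *\<^sub>R e) = (t - s) *\<^sub>R e"
        by (simp add: algebra_simps)
      ultimately have "(t - s) *\<^sub>R e \<in> P"
        by simp
      then show ?thesis
        by (simp add: e_multiple)
    qed
    then show ?thesis
      by (rule bdd_aboveI)
  qed
  have f_upper: "t \<le> f x" if "x - t *\<^sub>R e \<in> P" for x t
    unfolding f_def using that by (intro cSup_upper T_bdd) (simp add: T_def)
  have below_f: "x - t *\<^sub>R e \<in> P" if less: "t < f x" for x t
  proof -
    obtain s where "s \<in> T x" "t < s"
      using less_cSupE[OF less[unfolded f_def] T_nonempty] by metis
    then have "x - s *\<^sub>R e \<in> P"
      by (simp add: T_def)
    moreover have "(s - t) *\<^sub>R e \<in> P"
      using \<open>t < s\<close> by (simp add: e_multiple)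
    ultimately have "(x - s *\<^sub>R e) + (s - t) *\<^sub>R e \<in> P"
      by (intro add)
    then show ?thesis
      by (simp add: algebra_simps)
  qed
  \<comment> \<open>The supremum need not be attained, so each summand gives up half of the
    error.\<close>
  have superadd: "f x + f y \<le> f (x + y)" for x y
  proof (rule field_le_epsilon)
    fix \<epsilon> :: real assume "0 < \<epsilon>"
    then have "(x - (f x - \<epsilon>/2) *\<^sub>R e) + (y - (f y - \<epsilon>/2) *\<^sub>R e) \<in> P"
      by (intro add below_f) auto
    moreover have "(x - (f x - \<epsilon>/2) *\<^sub>R e) + (y - (f y - \<epsilon>/2) *\<^sub>R e)
        = (x + y) - ((f x - \<epsilon>/2) + (f y - \<epsilon>/2)) *\<^sub>R e"
      unfolding scaleR_left_distrib by simp
    ultimately have "(f x - \<epsilon>/2) + (f y - \<epsilon>/2) \<le> f (x + y)"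
      using f_upper by metis
    then show "f x + f y \<le> f (x + y) + \<epsilon>"
      by simp
  qed
  have f_minus_ge: "- f x \<le> f (- x)" for x
  proof (rule field_le_epsilon)
    fix \<epsilon> :: real assume "0 < \<epsilon>"
    then have "x - (f x + \<epsilon>) *\<^sub>R e \<notin> P"
      using f_upper[of x "f x + \<epsilon>"] by auto
    then have "- (x - (f x + \<epsilon>) *\<^sub>R e) \<in> P"
      using total by blast
    moreover have "- (x - (f x + \<epsilon>) *\<^sub>R e) = - x - (- (f x + \<epsilon>)) *\<^sub>R e"
      by (simp only: scaleR_minus_left) simp
    ultimately have "- (f x + \<epsilon>) \<le> f (- x)"
      using f_upper by metis
    then show "- f x \<le> f (- x) + \<epsilon>"
      by simp
  qed
  \<comment> \<open>For the upper bound, superadditivity at \<open>x + y\<close> and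
    \<open>- y\<close> gives f(x+y) + f(-y) \<le> f(x), and f(-y) \<ge> -f(y).\<close>
  have f_add: "f (x + y) = f x + f y" for x y
    using superadd[of x y] superadd[of "x + y" "- y"] f_minus_ge[of y] by simp
  have f_zero: "f 0 = 0"
    using f_add[of 0 0] by simp
  have f_minus: "f (- x) = - f x" for x
    using f_add[of x "- x"] f_zero by simp
  have f_scale_ge: "c * f x \<le> f (c *\<^sub>R x)" if "0 < c" for c x
  proof -
    have "s \<le> f (c *\<^sub>R x) / c" if "s < f x" for s
    proof -
      have "c *\<^sub>R (x - s *\<^sub>R e) \<in> P"
        using \<open>0 < c\<close> that by (intro scale below_f) auto
      then have "c *\<^sub>R x - (c * s) *\<^sub>R e \<in> P"
        by (simp add: algebra_simps)
      from f_upper[OF this] show ?thesis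
        using \<open>0 < c\<close> by (simp add: field_simps)
    qed
    then have "f x \<le> f (c *\<^sub>R x) / c"
      by (rule dense_le)
    then show ?thesis
      using that by (simp add: field_simps)
  qed
  have f_scale_pos: "f (c *\<^sub>R x) = c * f x" if "0 < c" for c x
    using f_scale_ge[OF that, of x] f_scale_ge[OF that, of "- x"] by (simp add: f_minus)
  have f_scale: "f (c *\<^sub>R x) = c * f x" for c x
  proof (cases c "0::real" rule: linorder_cases)
    case less
    then have "f ((- c) *\<^sub>R x) = (- c) * f x"
      by (intro f_scale_pos) simp
    then show ?thesis
      by (simp add: f_minus)
  qed (use f_scale_pos f_zero in auto)
  have "linear f"
    by (intro linearI) (auto simp: f_add f_scale)
  moreover have "f e = 1"
  proof -
    have "T e = {..1}"
      unfolding T_def using e_multiple[of "1 - _"] by (auto simp: algebra_simps)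
    then show ?thesis
      by (simp add: f_def)
  qed
  moreover have "0 \<le> f x" if "x \<in> P" for x
    using f_upper[of x 0] that by simp
  ultimately show thesis
    using that by blast
qed

text \<open>As \<open>K\<close> is convex, the cone it generates consists of nonnegative multiples
  of its points. It avoids \<open>- e\<close> because \<open>0 \<notin> K\<close>, and
  \<open>internal\<close> turns \<open>e\<close> into an order unit.\<close>

lemma Hahn_Banach_convex:
  fixes K :: "'a::real_vector set"
  assumes "convex K" and "0 \<notin> K" and "e \<in> K"
    and internal: "\<And>x. \<exists>\<epsilon>>0. e + \<epsilon> *\<^sub>R x \<in> K"
  shows "\<exists>f :: 'a \<Rightarrow> real. linear f \<and> f e = 1 \<and> (\<forall>x\<in>K. 0 \<le> f x)"
proof -
  define C where "C = convex_cone hull K"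
  have C_eq: "C = {c *\<^sub>R x | c x. 0 \<le> c \<and> x \<in> K}"
  proof -
    have "C = (\<Union>x \<in> K. \<Union>c\<in>{0..}. {c *\<^sub>R x})"
      unfolding C_def using convex_cone_hull_convex_hull_nonempty[of K] \<open>e \<in> K\<close>
        hull_same[of convex, OF \<open>convex K\<close>] by fastforce
    then show ?thesis
      by blast
  qed
  have "- e \<notin> C"
  proof
    assume "- e \<in> C"
    then obtain c x where c: "- e = c *\<^sub>R x" "0 \<le> c" "x \<in> K"
      unfolding C_eq by blast
    \<comment> \<open>Normalising the relation e + c x = 0 to a convex combination would put 0 into
      \<open>K\<close>.\<close>
    have "(1 / (1 + c)) *\<^sub>R e + (c / (1 + c)) *\<^sub>R x \<in> K"
      using \<open>convex K\<close> c \<open>e \<in> K\<close> by (intro convexD) (auto simp: field_simps)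
    moreover have "(1 / (1 + c)) *\<^sub>R e + (c / (1 + c)) *\<^sub>R x = (1 / (1 + c)) *\<^sub>R (e + c *\<^sub>R x)"
      by (simp add: algebra_simps)
    moreover have "e + c *\<^sub>R x = 0"
      using c(1) by (metis add.right_inverse)
    ultimately show False
      using \<open>0 \<notin> K\<close> by simp
  qed
  moreover have "convex_cone C"
    unfolding C_def by (rule convex_cone_convex_cone_hull)
  ultimately obtain P where P: "convex_cone P" "C \<subseteq> P" "- e \<notin> P" "\<And>x. x \<in> P \<or> - x \<in> P"
    using total_convex_cone_extension by metis
  have "K \<subseteq> P"
    using P(2) hull_subset[of K convex_cone] unfolding C_def by (rule subset_trans[rotated])
  have "\<exists>t. x + t *\<^sub>R e \<in> P" for x
  proof -
    obtain \<epsilon> where "\<epsilon> > 0" "e + \<epsilon> *\<^sub>R x \<in> K"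
      using internal by blast
    then have "(1 / \<epsilon>) *\<^sub>R (e + \<epsilon> *\<^sub>R x) \<in> P"
      using \<open>K \<subseteq> P\<close> by (intro convex_cone_scaleR[OF P(1)]) auto
    then have "x + (1 / \<epsilon>) *\<^sub>R e \<in> P"
      using \<open>\<epsilon> > 0\<close> by (simp add: algebra_simps)
    then show ?thesis
      by blast
  qed
  then obtain f :: "'a \<Rightarrow> real" where "linear f" "f e = 1" "\<And>x. x \<in> P \<Longrightarrow> 0 \<le> f x"
    using total_convex_cone_functional[OF P(1,3,4)] by metis
  with \<open>K \<subseteq> P\<close> show ?thesis
    by blast
qed

section \<open>Continuity of functionals, and separation of a point from a closed convex set\<close>

lemma continuous_on_scaleR_lcs:
  fixes f :: "'b::topological_space \<Rightarrow> real" and g :: "'b \<Rightarrow> 'a::locally_convex_space"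
  assumes "continuous_on S f" "continuous_on S g"
  shows "continuous_on S (\<lambda>x. f x *\<^sub>R g x)"
  unfolding continuous_on_def
proof
  fix x assume "x \<in> S"
  then have "LIM y (at x within S). (f y, g y) :> nhds (f x) \<times>\<^sub>F nhds (g x)"
    using assms by (intro filterlim_Pair) (auto simp: continuous_on_def)
  from filterlim_compose[OF tendsto_scaleR_Pair this]
  show "((\<lambda>x. f x *\<^sub>R g x) \<longlongrightarrow> f x *\<^sub>R g x) (at x within S)"
    by simp
qed

text \<open>Testing the one-sided bound at \<open>e\<close> plus and minus a multiple of
  \<open>y - x\<close> yields a two-sided bound on \<open>f y - f x\<close>.\<close>

lemma linear_continuous_if_bounded_below:
  fixes f :: "'a::locally_convex_space \<Rightarrow> real"
  assumes "linear f" and "open W" and "e \<in> W" and bound: "\<And>x. x \<in> W \<Longrightarrow> c \<le> f x"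
  shows "continuous_on UNIV f"
proof (rule continuous_on_topological[THEN iffD2], intro ballI allI impI)
  fix x and B :: "real set" assume "open B" "f x \<in> B"
  then obtain \<epsilon> where "\<epsilon> > 0" and \<epsilon>: "ball (f x) \<epsilon> \<subseteq> B"
    using openE by blast
  \<comment> \<open>The extra 1 makes \<open>M\<close> positive and the estimate below
    strict.\<close>
  define M where "M = f e - c + 1"
  have "M > 0"
    using bound[OF \<open>e \<in> W\<close>] by (simp add: M_def)
  define \<delta> where "\<delta> = M / \<epsilon>"
  define A where "A = (\<lambda>y. e + \<delta> *\<^sub>R (y - x)) -` W \<inter> (\<lambda>y. e + \<delta> *\<^sub>R (x - y)) -` W"
  have "open A"
    unfolding A_def using \<open>open W\<close>
    by (intro open_Int open_vimage continuous_intros continuous_on_scaleR_lcs)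
  moreover have "x \<in> A"
    using \<open>e \<in> W\<close> by (simp add: A_def)
  moreover have "f y \<in> B" if "y \<in> A" for y
  proof -
    have "c \<le> f e + \<delta> * (f y - f x)" "c \<le> f e + \<delta> * (f x - f y)"
      using that bound[of "e + \<delta> *\<^sub>R (y - x)"] bound[of "e + \<delta> *\<^sub>R (x - y)"] \<open>linear f\<close>
      by (auto simp: A_def linear_add linear_diff linear_scale)
    then have "\<delta> * \<bar>f y - f x\<bar> < M"
      by (auto simp: M_def abs_if algebra_simps)
    then have "\<bar>f y - f x\<bar> < \<epsilon>"
      using \<open>M > 0\<close> \<open>\<epsilon> > 0\<close> by (simp add: \<delta>_def field_simps)
    then have "f y \<in> ball (f x) \<epsilon>"
      by (simp add: dist_real_def abs_minus_commute)
    then show ?thesis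
      using \<epsilon> by blast
  qed
  ultimately show "\<exists>A. open A \<and> x \<in> A \<and> (\<forall>y\<in>UNIV. y \<in> A \<longrightarrow> f y \<in> B)"
    by blast
qed

lemma linear_pairing: "linear (pairing f)"
  and continuous_pairing: "continuous_on UNIV (pairing f)"
  using pairing[of f] by auto

lemmas pairing_simps =
  linear_add[OF linear_pairing] linear_diff[OF linear_pairing] linear_scale[OF linear_pairing]
  linear_neg[OF linear_pairing] linear_0[OF linear_pairing]
  zero_dual.rep_eq plus_dual.rep_eq minus_dual.rep_eq uminus_dual.rep_eq scaleR_dual.rep_eq

text \<open>With \<open>V\<close> a convex neighbourhood of \<open>z\<close> disjoint from
  \<open>C\<close>, the set of differences of \<open>C\<close> and \<open>V\<close> is open, convex
  and avoids 0, so it admits a nonnegative functional, continuous since it is bounded below on an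
  open set.\<close>

theorem separation_closed_point:
  fixes C :: "'a::locally_convex_space set"
  assumes "convex C" and "closed C" and "z \<notin> C"
  obtains f :: "'a dual" and \<alpha> :: real where "pairing f z < \<alpha>" "\<And>x. x \<in> C \<Longrightarrow> \<alpha> \<le> pairing f x"
proof (cases "C = {}")
  case True
  then show thesis
    using that[of 0 1] by (simp add: pairing_simps)
next
  case False
  have "open (- C)" "z \<in> - C"
    using assms by auto
  from locally_convex[OF this] obtain V where V: "open V" "convex V" "z \<in> V" "V \<inter> C = {}"
    by blast
  define K where "K = (\<Union>x\<in>C. \<Union>v\<in>V. {x - v})"
  have "K = (\<Union>x\<in>C. (\<lambda>v. x - v) -` V)"
  proof (rule set_eqI)
    fix y :: 'a
    have "y = x - v \<longleftrightarrow> v = x - y" for x v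
      by (auto simp: algebra_simps)
    then show "y \<in> K \<longleftrightarrow> y \<in> (\<Union>x\<in>C. (\<lambda>v. x - v) -` V)"
      by (auto simp: K_def)
  qed
  moreover have "open ((\<lambda>v. x - v) -` V)" for x
    using \<open>open V\<close> by (intro open_vimage continuous_on_diff continuous_on_const continuous_on_id)
  ultimately have "open K"
    by auto
  have "convex K"
    unfolding K_def using \<open>convex C\<close> \<open>convex V\<close> by (rule convex_differences)
  have "0 \<notin> K"
    using V(4) by (auto simp: K_def)
  obtain x\<^sub>0 where "x\<^sub>0 \<in> C"
    using False by blast
  define e where "e = x\<^sub>0 - z"
  have "e \<in> K"
    using \<open>x\<^sub>0 \<in> C\<close> \<open>z \<in> V\<close> by (auto simp: K_def e_def)
  have small: "\<exists>\<epsilon>>0. a + \<epsilon> *\<^sub>R x \<in> S" if "open S" "a \<in> S" for S and a x :: 'a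
  proof -
    have "open ((\<lambda>t. a + t *\<^sub>R x) -` S)"
      using \<open>open S\<close> by (intro open_vimage continuous_intros continuous_on_scaleR_lcs)
    moreover have "0 \<in> (\<lambda>t. a + t *\<^sub>R x) -` S"
      using \<open>a \<in> S\<close> by simp
    ultimately obtain \<epsilon> where "\<epsilon> > 0" "cball 0 \<epsilon> \<subseteq> (\<lambda>t. a + t *\<^sub>R x) -` S"
      using open_contains_cball by metis
    moreover from this have "\<epsilon> \<in> cball 0 \<epsilon>"
      by simp
    ultimately show ?thesis
      by blast
  qed
  obtain f :: "'a \<Rightarrow> real" where f: "linear f" "f e = 1" and f_nonneg: "\<And>x. x \<in> K \<Longrightarrow> 0 \<le> f x"
    using Hahn_Banach_convex[OF \<open>convex K\<close> \<open>0 \<notin> K\<close> \<open>e \<in> K\<close> small[OF \<open>open K\<close> \<open>e \<in> K\<close>]] by blast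
  have "continuous_on UNIV f"
    using f(1) \<open>open K\<close> \<open>e \<in> K\<close> f_nonneg by (rule linear_continuous_if_bounded_below)
  then have pairing_f: "pairing (Dual f) = f"
    using f(1) by (simp add: Dual_inverse)
  \<comment> \<open>Strictness comes from here: \<open>V\<close> also contains a point slightly
    beyond \<open>z\<close> in direction \<open>e\<close>, where \<open>f\<close> is larger by
    \<open>\<epsilon>\<close>.\<close>
  obtain \<epsilon> where "\<epsilon> > 0" "z + \<epsilon> *\<^sub>R e \<in> V"
    using small[OF \<open>open V\<close> \<open>z \<in> V\<close>] by blast
  have "f z + \<epsilon> \<le> f x" if "x \<in> C" for x
    using f_nonneg[of "x - (z + \<epsilon> *\<^sub>R e)"] that \<open>z + \<epsilon> *\<^sub>R e \<in> V\<close> f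
    by (auto simp: K_def linear_add linear_diff linear_scale)
  then show thesis
    using that[of "Dual f" "f z + \<epsilon>"] \<open>\<epsilon> > 0\<close> by (simp add: pairing_f)
qed

text \<open>Applied to functionals on \<open>X \<times> \<real>\<close> for epigraphs of
  \<open>h\<close>, and on the product of the weak* dual with the reals for
  \<open>F_sharp\<close>.\<close>

lemma dual_prod_real:
  fixes f :: "('a::locally_convex_space \<times> real) dual"
  obtains g :: "'a dual" and r :: real where "\<And>x s. pairing f (x, s) = pairing g x + r * s"
proof -
  define g where "g x = pairing f (x, 0)" for x
  have "linear g"
  proof (rule linearI)
    show "g (x + y) = g x + g y" for x y
      using linear_add[OF linear_pairing, of f "(x, 0)" "(y, 0)"] by (simp add: g_def)
    show "g (c *\<^sub>R x) = c *\<^sub>R g x" for c x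
      using linear_scale[OF linear_pairing, of f c "(x, 0)"] by (simp add: g_def)
  qed
  moreover have "continuous_on UNIV g"
    unfolding g_def
    by (rule continuous_on_compose2[OF continuous_pairing]) (auto intro!: continuous_intros)
  ultimately have pairing_g: "pairing (Dual g) = g"
    by (simp add: Dual_inverse)
  have "pairing f (x, s) = pairing (Dual g) x + pairing f (0, 1) * s" for x s
  proof -
    have "(x, s) = (x, 0) + s *\<^sub>R (0, 1)"
      by simp
    then have "pairing f (x, s) = pairing f (x, 0) + s * pairing f (0, 1)"
      by (simp only: linear_add[OF linear_pairing] linear_scale[OF linear_pairing] real_scaleR_def)
    then show ?thesis
      by (simp add: pairing_g g_def)
  qed
  then show thesis
    using that by blast
qed

section \<open>The dual of the weak* topology\<close>

text \<open>A functional vanishing on the common kernel of finitely many evaluations is a linear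
  combination of them, and such a combination is again an evaluation.\<close>

lemma functional_in_span_of_evaluations:
  fixes \<phi> :: "'a::locally_convex_space dual \<Rightarrow> real"
  assumes "finite I" and "linear \<phi>"
    and "\<And>a. (\<forall>i\<in>I. pairing a i = 0) \<Longrightarrow> \<phi> a = 0"
  shows "\<exists>x. \<forall>a. \<phi> a = pairing a x"
  using assms
proof (induction I arbitrary: \<phi> rule: finite_induct)
  case empty
  then show ?case
    by (intro exI[of _ 0]) (simp add: pairing_simps)
next
  case (insert j I)
  show ?case
  proof (cases "\<exists>b. (\<forall>i\<in>I. pairing b i = 0) \<and> pairing b j \<noteq> 0")
    case False
    then show ?thesis
      by (intro insert.IH insert.prems) (use False in auto)
  next
    case True
    then obtain b' where b': "\<forall>i\<in>I. pairing b' i = 0" "pairing b' j \<noteq> 0"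
      by blast
    define b where "b = (1 / pairing b' j) *\<^sub>R b'"
    have b: "\<forall>i\<in>I. pairing b i = 0" "pairing b j = 1"
      using b' by (simp_all add: b_def pairing_simps)
    \<comment> \<open>Subtracting the component along \<open>b\<close>, which is 1 at
      \<open>j\<close> and 0 on \<open>I\<close>, leaves a functional that no longer depends on
      \<open>j\<close>.\<close>
    define \<psi> where "\<psi> a = \<phi> a - pairing a j * \<phi> b" for a
    have "linear \<psi>"
      by (rule linearI)
        (simp_all add: \<psi>_def pairing_simps linear_add[OF insert.prems(1)]
          linear_scale[OF insert.prems(1)] algebra_simps)
    moreover have "\<psi> a = 0" if "\<forall>i\<in>I. pairing a i = 0" for a
    proof -
      have "\<phi> (a - pairing a j *\<^sub>R b) = 0"
        using that b by (intro insert.prems(2)) (auto simp: pairing_simps)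
      then show ?thesis
        by (simp add: \<psi>_def linear_diff[OF insert.prems(1)] linear_scale[OF insert.prems(1)])
    qed
    ultimately obtain x where x: "\<forall>a. \<psi> a = pairing a x"
      using insert.IH by blast
    have "\<phi> a = pairing a (x + \<phi> b *\<^sub>R j)" for a
      using x[rule_format, of a] by (simp add: \<psi>_def pairing_simps mult.commute)
    then show ?thesis
      by blast
  qed
qed

text \<open>Continuity at 0 bounds the functional on a basic neighbourhood restricting only finitely
  many coordinates. Where these vanish, every scalar multiple stays in the neighbourhood, so the
  functional is 0.\<close>

theorem weak_star_dual_is_evaluation:
  fixes \<phi> :: "'a::locally_convex_space dual dual"
  obtains x where "\<And>a. pairing \<phi> a = pairing a x"
proof -
  define N where "N = pairing \<phi> -` ball 0 1"
  have "open N"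
    unfolding N_def using continuous_pairing by (intro open_vimage) auto
  then obtain T where T: "open T" "N = pairing -` T"
    unfolding open_dual_def by blast
  have "0 \<in> N"
    by (simp add: N_def pairing_simps)
  then have "pairing 0 \<in> T"
    using T by auto
  then obtain X where X: "pairing 0 \<in> Pi\<^sub>E UNIV X"
      "finite {i. X i \<noteq> UNIV}" "Pi\<^sub>E UNIV X \<subseteq> T"
    using \<open>open T\<close> product_topology_open_contains_basis[of "\<lambda>_. euclidean" UNIV T "pairing 0"]
    unfolding open_fun_def by auto
  have "pairing \<phi> a = 0" if a: "\<forall>i\<in>{i. X i \<noteq> UNIV}. pairing a i = 0" for a
  proof -
    have small: "\<bar>c * pairing \<phi> a\<bar> < 1" for c
    proof -
      have "pairing (c *\<^sub>R a) i \<in> X i" for i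
        using a X(1) by (cases "X i = UNIV") (auto simp: pairing_simps PiE_iff)
      then have "c *\<^sub>R a \<in> N"
        using X(3) T(2) by (auto simp: PiE_iff)
      then show ?thesis
        by (simp add: N_def pairing_simps)
    qed
    show ?thesis
      using small[of "1 / pairing \<phi> a"] by (cases "pairing \<phi> a = 0") auto
  qed
  then show thesis
    using functional_in_span_of_evaluations[OF X(2) linear_pairing] that by blast
qed

section \<open>Separation in the product of the weak* dual with the reals\<close>

lemma convex_closure_lcs:
  fixes S :: "'a::locally_convex_space set"
  assumes "convex S"
  shows "convex (closure S)"
proof (rule convexI)
  fix x y and u v :: real
  assume xy: "x \<in> closure S" "y \<in> closure S" and uv: "0 \<le> u" "0 \<le> v" "u + v = 1"
  let ?g = "\<lambda>p. u *\<^sub>R fst p + v *\<^sub>R snd p"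
  \<comment> \<open>A fixed convex combination is a continuous map on pairs, so its action on
    \<open>S \<times> S\<close> passes to closures.\<close>
  have "?g ` closure (S \<times> S) \<subseteq> closure S"
  proof (rule image_closure_subset)
    show "continuous_on (closure (S \<times> S)) ?g"
      by (intro continuous_intros continuous_on_scaleR_lcs)
    show "?g ` (S \<times> S) \<subseteq> closure S"
      using convexD[OF assms _ _ uv] closure_subset by fastforce
  qed simp
  moreover have "(x, y) \<in> closure (S \<times> S)"
    using xy by (simp add: closure_Times)
  ultimately show "u *\<^sub>R x + v *\<^sub>R y \<in> closure S"
    by force
qed

lemma separation_weak_star_point:
  fixes C :: "('a::locally_convex_space dual \<times> real) set"
  assumes "(a, s) \<notin> closure (convex hull C)"
  obtains x r \<alpha> where "pairing a x + r * s < \<alpha>"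
    "\<And>b t. (b, t) \<in> C \<Longrightarrow> \<alpha> \<le> pairing b x + r * t"
proof -
  have "convex (closure (convex hull C))"
    by (intro convex_closure_lcs convex_convex_hull)
  then obtain f \<alpha> where f: "pairing f (a, s) < \<alpha>"
      "\<And>p. p \<in> closure (convex hull C) \<Longrightarrow> \<alpha> \<le> pairing f p"
    using assms separation_closed_point closed_closure by metis
  have C_sub: "C \<subseteq> closure (convex hull C)"
    using hull_subset closure_subset by (rule subset_trans)
  obtain \<phi> r where \<phi>: "\<And>b t. pairing f (b, t) = pairing \<phi> b + r * t"
    using dual_prod_real by blast
  obtain x where x: "\<And>b. pairing \<phi> b = pairing b x"
    using weak_star_dual_is_evaluation by blast
  show thesis
  proof
    show "pairing a x + r * s < \<alpha>"
      using f(1) by (simp add: \<phi> x)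
    show "\<alpha> \<le> pairing b x + r * t" if "(b, t) \<in> C" for b t
      using f(2)[of "(b, t)"] that C_sub by (auto simp: \<phi> x)
  qed
qed

section \<open>The Fenchel--Moreau theorem\<close>

text \<open>A level \<open>c\<close> strictly between \<open>r\<close> and \<open>h x\<close> gives
  a product neighbourhood of \<open>(x, r)\<close> missing the epigraph.\<close>

lemma closed_epigraph:
  assumes "lsc_fun h"
  shows "closed {(x, r :: real). h x \<le> ereal r}"
proof -
  have "open (- {(x, r :: real). h x \<le> ereal r})"
  proof (rule open_prod_intro)
    fix p assume "p \<in> - {(x, r :: real). h x \<le> ereal r}"
    then obtain x r where p: "p = (x, r)" "ereal r < h x"
      by (cases p) auto
    then obtain c where c: "ereal r < ereal c" "ereal c < h x"
      using ereal_dense2 by blast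
    have "\<forall>\<^sub>F y in nhds x. ereal c < h y"
      using assms c(2) by (simp add: lsc_fun_def)
    then obtain S where "open S" "x \<in> S" "\<And>y. y \<in> S \<Longrightarrow> ereal c < h y"
      unfolding eventually_nhds by blast
    moreover have "\<not> h y \<le> ereal s" if "y \<in> S" "s < c" for y s
      using calculation(3)[OF that(1)] that(2) by (meson ereal_less_eq(3) less_le_not_le order_trans)
    ultimately show
      "\<exists>A B. open A \<and> open B \<and> p \<in> A \<times> B \<and> A \<times> B \<subseteq> - {(x, r :: real). h x \<le> ereal r}"
      using p c by (intro exI[of _ S] exI[of _ "{..<c}"]) auto
  qed
  then show ?thesis
    by (simp add: closed_def)
qed

lemma epigraph_separation:
  fixes h :: "'a::locally_convex_space \<Rightarrow> ereal"
  assumes "proper_fun h" "convex_fun h" "lsc_fun h" and "ereal c < h x"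
  obtains f r \<alpha> where "0 \<le> r" "pairing f x + r * c < \<alpha>"
    "\<And>y s. h y \<le> ereal s \<Longrightarrow> \<alpha> \<le> pairing f y + r * s"
proof -
  define E where "E = {(y, s :: real). h y \<le> ereal s}"
  have "convex E" "closed E" "(x, c) \<notin> E"
    using assms closed_epigraph by (auto simp: E_def convex_fun_def)
  then obtain g \<alpha> where g: "pairing g (x, c) < \<alpha>" "\<And>p. p \<in> E \<Longrightarrow> \<alpha> \<le> pairing g p"
    using separation_closed_point by metis
  obtain f r where f: "\<And>y s. pairing g (y, s) = pairing f y + r * s"
    using dual_prod_real by blast
  have bound: "\<alpha> \<le> pairing f y + r * s" if "h y \<le> ereal s" for y s
    using g(2)[of "(y, s)"] that by (simp add: E_def f)
  obtain y s where y: "h y = ereal s"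
    using \<open>proper_fun h\<close> unfolding proper_fun_def by (metis ereal_cases)
  have "0 \<le> r"
  proof (rule ccontr)
    assume "\<not> 0 \<le> r"
    \<comment> \<open>The maximum keeps \<open>(y, t)\<close> in the epigraph, while for negative
      \<open>r\<close> the second entry pushes the functional below \<open>\<alpha>\<close>.\<close>
    define t where "t = max s ((\<alpha> - pairing f y) / r + 1)"
    have "r * t \<le> r * ((\<alpha> - pairing f y) / r + 1)"
      using \<open>\<not> 0 \<le> r\<close> by (intro mult_left_mono_neg) (auto simp: t_def)
    also have "\<dots> < \<alpha> - pairing f y"
      using \<open>\<not> 0 \<le> r\<close> by (simp add: distrib_left)
    finally show False
      using bound[of y t] y by (simp add: t_def)
  qed
  with that g(1) bound show thesis
    by (simp add: f)
qed

text \<open>A nonvertical separating hyperplane is the graph of the minorant. A vertical one must be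
  combined with a nonvertical one, which exists over any point where \<open>h\<close> is
  finite.\<close>

lemma affine_minorant:
  fixes h :: "'a::locally_convex_space \<Rightarrow> ereal"
  assumes h: "proper_fun h" "convex_fun h" "lsc_fun h" and "ereal c < h x"
  obtains a \<beta> where "c \<le> pairing a x - \<beta>" "\<And>y. ereal (pairing a y - \<beta>) \<le> h y"
proof -
  have nonvertical: "\<exists>a \<beta>. c \<le> pairing a x - \<beta> \<and> (\<forall>y. ereal (pairing a y - \<beta>) \<le> h y)"
    if "0 < r" and sep: "pairing f x + r * c < \<alpha>" "\<And>y s. h y \<le> ereal s \<Longrightarrow> \<alpha> \<le> pairing f y + r * s"
    for f r \<alpha> c x
  proof (intro exI conjI allI)
    let ?a = "(- 1 / r) *\<^sub>R f" and ?\<beta> = "- \<alpha> / r"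
    show "c \<le> pairing ?a x - ?\<beta>"
      using \<open>0 < r\<close> sep(1) by (simp add: pairing_simps field_simps)
    show "ereal (pairing ?a y - ?\<beta>) \<le> h y" for y
    proof (cases "h y")
      case (real s)
      then show ?thesis
        using \<open>0 < r\<close> sep(2)[of y s] by (simp add: pairing_simps field_simps)
    next
      case MInf
      then show ?thesis
        using \<open>proper_fun h\<close> by (simp add: proper_fun_def)
    qed simp
  qed
  obtain f r \<alpha> where "0 \<le> r" and sep: "pairing f x + r * c < \<alpha>"
      "\<And>y s. h y \<le> ereal s \<Longrightarrow> \<alpha> \<le> pairing f y + r * s"
    using epigraph_separation[OF assms] by metis
  show thesis
  proof (cases "r = 0")
    case False
    then show ?thesis
      using nonvertical[OF _ sep] \<open>0 \<le> r\<close> that by force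
  next
    case True
    \<comment> \<open>The separating hyperplane is vertical: tilt an arbitrary affine minorant by multiples of it.\<close>
    obtain x\<^sub>0 s\<^sub>0 where x\<^sub>0: "h x\<^sub>0 = ereal s\<^sub>0"
      using \<open>proper_fun h\<close> unfolding proper_fun_def by (metis ereal_cases)
    then have "ereal (s\<^sub>0 - 1) < h x\<^sub>0"
      by simp
    then obtain f' r' \<alpha>' where "0 \<le> r'" and sep': "pairing f' x\<^sub>0 + r' * (s\<^sub>0 - 1) < \<alpha>'"
        "\<And>y s. h y \<le> ereal s \<Longrightarrow> \<alpha>' \<le> pairing f' y + r' * s"
      using epigraph_separation[OF h] by metis
    \<comment> \<open>The point \<open>(x\<^sub>0, s\<^sub>0)\<close> of the epigraph lies directly
      above the separated one, so the hyperplane cannot be vertical.\<close>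
    have "0 < r'"
      using sep'(1) sep'(2)[of x\<^sub>0 s\<^sub>0] x\<^sub>0 by (simp add: algebra_simps)
    then obtain a \<beta> where a: "\<And>y. ereal (pairing a y - \<beta>) \<le> h y"
      using nonvertical[OF _ sep'] by blast
    define \<delta> where "\<delta> = \<alpha> - pairing f x"
    have "\<delta> > 0"
      using sep(1) True by (simp add: \<delta>_def)
    \<comment> \<open>Tilting gains \<open>t * \<delta>\<close> at \<open>x\<close>, so this
      \<open>t\<close> lifts the minorant to \<open>c\<close> there; where \<open>h\<close> is
      finite, tilting only lowers it.\<close>
    define t where "t = \<bar>c - (pairing a x - \<beta>)\<bar> / \<delta>"
    have "t \<ge> 0" "t * \<delta> \<ge> c - (pairing a x - \<beta>)"
      using \<open>\<delta> > 0\<close> by (auto simp: t_def)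
    show ?thesis
    proof (rule that[of "a - t *\<^sub>R f" "\<beta> - t * \<alpha>"])
      show "c \<le> pairing (a - t *\<^sub>R f) x - (\<beta> - t * \<alpha>)"
        using \<open>t * \<delta> \<ge> c - (pairing a x - \<beta>)\<close> by (simp add: pairing_simps \<delta>_def algebra_simps)
      show "ereal (pairing (a - t *\<^sub>R f) y - (\<beta> - t * \<alpha>)) \<le> h y" for y
      proof (cases "h y")
        case (real s)
        then have "t * \<alpha> \<le> t * pairing f y"
          using sep(2)[of y s] True \<open>t \<ge> 0\<close> by (intro mult_left_mono) auto
        then have "pairing (a - t *\<^sub>R f) y - (\<beta> - t * \<alpha>) \<le> pairing a y - \<beta>"
          by (simp add: pairing_simps algebra_simps)
        then show ?thesis
          using a[of y] by (meson ereal_less_eq(3) order_trans)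
      next
        case MInf
        then show ?thesis
          using \<open>proper_fun h\<close> by (simp add: proper_fun_def)
      qed simp
    qed
  qed
qed

section \<open>The robust S-procedure\<close>

lemma ereal_diff_le_swap:
  "ereal p - y \<le> ereal q \<longleftrightarrow> ereal (p - q) \<le> y"
  by (cases y) auto

lemma conjugate_le_iff:
  "conjugate h a \<le> ereal \<beta> \<longleftrightarrow> (\<forall>x. ereal (pairing a x - \<beta>) \<le> h x)"
  by (simp add: conjugate_def SUP_le_iff ereal_diff_le_swap)

text \<open>Each real \<open>c\<close> below \<open>h x\<close> is reached by an affine minorant of
  \<open>h\<close>. Its slope lies in the domain of the conjugate, so (B) turns it into a minorant
  of some \<open>F u\<close> along \<open>y = 0\<close>, where \<open>\<mu>\<close> contributes
  nothing.\<close>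

lemma statement_B_imp_A:
  fixes F :: "'u \<Rightarrow> 'x::locally_convex_space \<times> 'y::locally_convex_space \<Rightarrow> ereal"
  assumes h: "proper_fun h" "convex_fun h" "lsc_fun h" and B: "statement_B h U F"
  shows "statement_A h U F"
  unfolding statement_A_def
proof
  fix x
  have "ereal c \<le> (SUP u\<in>U. F u (x, 0))" if c: "ereal c < h x" for c
  proof -
    obtain a \<beta> where a: "c \<le> pairing a x - \<beta>" "\<And>y. ereal (pairing a y - \<beta>) \<le> h y"
      using affine_minorant[OF h c] by metis
    then have le: "conjugate h a \<le> ereal \<beta>"
      by (simp add: conjugate_le_iff)
    then have "a \<in> dom_conjugate h"
      by (auto simp: dom_conjugate_def intro: le_less_trans)
    then obtain u \<mu> where u: "u \<in> U" "conjugate2 (F u) (a, \<mu>) \<le> conjugate h a"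
      using B by (auto simp: statement_B_def)
    have "ereal (pairing a x + pairing \<mu> 0) - F u (x, 0) \<le> conjugate2 (F u) (a, \<mu>)"
      unfolding conjugate2_def by (auto intro!: SUP_upper2[of "(x, 0)"])
    also have "\<dots> \<le> ereal \<beta>"
      using u(2) le by (rule order_trans)
    finally have "ereal (pairing a x - \<beta>) \<le> F u (x, 0)"
      by (simp add: ereal_diff_le_swap pairing_simps)
    with a(1) have "ereal c \<le> F u (x, 0)"
      by (meson ereal_less_eq(3) order_trans)
    then show ?thesis
      using u(1) by (rule SUP_upper2[rotated])
  qed
  then show "h x \<le> (SUP u\<in>U. F u (x, 0))"
    by (meson ereal_dense2 linorder_not_le)
qed

section \<open>The supremum of biconjugates as the support function of
  \<open>F_sharp\<close>\<close>

lemma F_sharp_minorant: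
  assumes "(a, s) \<in> F_sharp U F"
  shows "ereal (pairing a y - s) \<le> (SUP u\<in>U. biconjugate2 (F u) (y, 0))"
proof -
  obtain u \<mu> where u: "u \<in> U" "conjugate2 (F u) (a, \<mu>) \<le> ereal s"
    using assms by (auto simp: F_sharp_def)
  have "ereal (pairing a y - s) \<le> ereal (pairing a y + pairing \<mu> 0) - conjugate2 (F u) (a, \<mu>)"
    using u(2) by (cases "conjugate2 (F u) (a, \<mu>)") (auto simp: pairing_simps)
  also have "\<dots> \<le> biconjugate2 (F u) (y, 0)"
    unfolding biconjugate2_def by (auto intro!: SUP_upper2[of "(a, \<mu>)"])
  also have "\<dots> \<le> (SUP u\<in>U. biconjugate2 (F u) (y, 0))"
    using u(1) by (rule SUP_upper)
  finally show ?thesis .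
qed

text \<open>With \<open>F_sharp_minorant\<close>, this lets bounds over \<open>F_sharp\<close>
  replace bounds on the supremum, whatever values the conjugates take.\<close>

lemma SUP_biconjugate2_le:
  assumes "\<And>a s. (a, s) \<in> F_sharp U F \<Longrightarrow> pairing a y - s \<le> \<gamma>"
  shows "(SUP u\<in>U. biconjugate2 (F u) (y, 0)) \<le> ereal \<gamma>"
proof (rule SUP_least)
  fix u assume "u \<in> U"
  have "ereal (pairing a y + pairing \<mu> 0) - conjugate2 (F u) (a, \<mu>) \<le> ereal \<gamma>" for a \<mu>
  proof -
    have le: "pairing a y - s \<le> \<gamma>" if "conjugate2 (F u) (a, \<mu>) \<le> ereal s" for s
      using assms that \<open>u \<in> U\<close> by (auto simp: F_sharp_def)
    show ?thesis
    proof (cases "conjugate2 (F u) (a, \<mu>)")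
      case (real s)
      then show ?thesis
        using le[of s] by (simp add: pairing_simps)
    next
      case MInf
      then show ?thesis
        \<comment> \<open>A conjugate value of minus infinity admits every \<open>s\<close>; this
          one would give \<gamma> + 1 \<le> \<gamma>.\<close>
        using le[of "pairing a y - \<gamma> - 1"] by simp
    qed simp
  qed
  then show "biconjugate2 (F u) (y, 0) \<le> ereal \<gamma>"
    unfolding biconjugate2_def by (auto intro: SUP_least)
qed

lemma in_closure_F_sharp:
  fixes U :: "'u set"
    and F :: "'u \<Rightarrow> 'x::locally_convex_space \<times> 'y::locally_convex_space \<Rightarrow> ereal"
  defines "G \<equiv> \<lambda>y. SUP u\<in>U. biconjugate2 (F u) (y, 0)"
  assumes minorant: "\<And>y. ereal (pairing a y - s) \<le> G y" and "G x\<^sub>0 \<noteq> \<infinity>"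
  shows "(a, s) \<in> closure (convex hull (F_sharp U F))"
proof (rule ccontr)
  assume "\<not> ?thesis"
  then obtain x r \<alpha> where sep: "pairing a x + r * s < \<alpha>"
    "\<And>b t. (b, t) \<in> F_sharp U F \<Longrightarrow> \<alpha> \<le> pairing b x + r * t"
    by (rule separation_weak_star_point) blast
  \<comment> \<open>Any bound at \<open>y\<close> shared by all pairs of \<open>F_sharp\<close>
    passes to \<open>(a, s)\<close>; both contradictions below come from this.\<close>
  have G_le: "pairing a y - s \<le> \<gamma>" if "\<And>b t. (b, t) \<in> F_sharp U F \<Longrightarrow> pairing b y - t \<le> \<gamma>" for y \<gamma>
  proof -
    have "G y \<le> ereal \<gamma>"
      unfolding G_def using that by (rule SUP_biconjugate2_le)
    then have "ereal (pairing a y - s) \<le> ereal \<gamma>"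
      using minorant by (rule order_trans[rotated])
    then show ?thesis
      by simp
  qed
  \<comment> \<open>Were \<open>F_sharp\<close> empty, \<open>G_le\<close> would hold vacuously with
    bound \<open>- s - 1\<close> at 0.\<close>
  obtain b t where bt: "(b, t) \<in> F_sharp U F"
    using G_le[of 0 "- s - 1"] by (auto simp: pairing_simps)
  have up: "(b, t') \<in> F_sharp U F" if "t \<le> t'" for t'
  proof -
    obtain u \<mu> where "u \<in> U" "conjugate2 (F u) (b, \<mu>) \<le> ereal t"
      using bt by (auto simp: F_sharp_def)
    moreover from this(2) have "conjugate2 (F u) (b, \<mu>) \<le> ereal t'"
      by (rule order_trans) (simp add: that)
    ultimately show ?thesis
      by (auto simp: F_sharp_def)
  qed
  have "0 \<le> r"
  proof (rule ccontr)
    assume "\<not> 0 \<le> r"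
    define t' where "t' = max t ((\<alpha> - pairing b x) / r + 1)"
    have "r * t' \<le> r * ((\<alpha> - pairing b x) / r + 1)"
      using \<open>\<not> 0 \<le> r\<close> by (intro mult_left_mono_neg) (auto simp: t'_def)
    also have "\<dots> < \<alpha> - pairing b x"
      using \<open>\<not> 0 \<le> r\<close> by (simp add: distrib_left)
    finally show False
      using sep(2)[OF up[of t']] by (simp add: t'_def)
  qed
  show False
  proof (cases "r = 0")
    case False
    with \<open>0 \<le> r\<close> have "0 < r"
      by simp
    have "pairing a ((- 1 / r) *\<^sub>R x) - s \<le> - \<alpha> / r"
    proof (rule G_le)
      fix b t assume "(b, t) \<in> F_sharp U F"
      then have "\<alpha> / r \<le> (pairing b x + r * t) / r"
        using sep(2) \<open>0 < r\<close> by (intro divide_right_mono) auto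
      then show "pairing b ((- 1 / r) *\<^sub>R x) - t \<le> - \<alpha> / r"
        using \<open>0 < r\<close> by (simp add: pairing_simps add_divide_distrib)
    qed
    moreover have "(pairing a x + r * s) / r < \<alpha> / r"
      using sep(1) \<open>0 < r\<close> by (rule divide_strict_right_mono)
    ultimately show False
      using \<open>0 < r\<close> by (simp add: pairing_simps add_divide_distrib)
  next
    case True
    obtain g where g: "G x\<^sub>0 = ereal g"
      using \<open>G x\<^sub>0 \<noteq> \<infinity>\<close> minorant[of x\<^sub>0] by (cases "G x\<^sub>0") auto
    define \<delta> where "\<delta> = \<alpha> - pairing a x"
    have "\<delta> > 0"
      using sep(1) True by (simp add: \<delta>_def)
    \<comment> \<open>The distance along the ray: the 1 makes \<open>c * \<delta>\<close> strictly
      exceed what the bound at \<open>x\<^sub>0\<close> allows.\<close>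
    define c where "c = (\<bar>g + s - pairing a x\<^sub>0\<bar> + 1) / \<delta>"
    have "c \<ge> 0" "c * \<delta> > g + s - pairing a x\<^sub>0"
      using \<open>\<delta> > 0\<close> by (auto simp: c_def)
    have "pairing a (x\<^sub>0 - c *\<^sub>R x) - s \<le> g - c * \<alpha>"
    proof (rule G_le)
      fix b t assume bt: "(b, t) \<in> F_sharp U F"
      have "pairing b x\<^sub>0 - t \<le> g"
        using F_sharp_minorant[OF bt, of x\<^sub>0] g by (simp add: G_def)
      moreover have "c * \<alpha> \<le> c * pairing b x"
        using sep(2)[OF bt] True \<open>c \<ge> 0\<close> by (intro mult_left_mono) auto
      ultimately show "pairing b (x\<^sub>0 - c *\<^sub>R x) - t \<le> g - c * \<alpha>"
        by (simp add: pairing_simps)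
    qed
    then show False
      using \<open>c * \<delta> > g + s - pairing a x\<^sub>0\<close> by (simp add: pairing_simps \<delta>_def algebra_simps)
  qed
qed

theorem theorem3:
  fixes U :: "'u set"
    and F :: "'u \<Rightarrow> 'x::locally_convex_space \<times> 'y::locally_convex_space \<Rightarrow> ereal"
    and h :: "'x \<Rightarrow> ereal"
  assumes "proper_fun h" and "convex_fun h" and "lsc_fun h"
    and "\<forall>a\<in>dom_conjugate h.
      (INF x. (SUP u\<in>U. F u (x, 0)) - ereal (pairing a x))
        = (INF x. (SUP u\<in>U. biconjugate2 (F u) (x, 0)) - ereal (pairing a x))
      \<and> (INF x. (SUP u\<in>U. biconjugate2 (F u) (x, 0)) - ereal (pairing a x)) \<noteq> \<infinity>"
    and "closed_convex_regarding (F_sharp U F) (gph_conjugate h)"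
  shows "S_procedure_valid h U F"
proof -
  have "statement_B h U F" if A: "statement_A h U F"
    unfolding statement_B_def
  proof
    fix a assume a: "a \<in> dom_conjugate h"
    define G where "G y = (SUP u\<in>U. biconjugate2 (F u) (y, 0))" for y
    \<comment> \<open>A point where \<open>h\<close> is finite excludes the value minus infinity for
      the conjugate.\<close>
    obtain x\<^sub>1 where "h x\<^sub>1 \<noteq> \<infinity>"
      using \<open>proper_fun h\<close> by (auto simp: proper_fun_def)
    moreover have "ereal (pairing a x\<^sub>1) - h x\<^sub>1 \<le> conjugate h a"
      unfolding conjugate_def by (rule SUP_upper) simp
    ultimately obtain s where s: "conjugate h a = ereal s"
      using a by (cases "conjugate h a"; cases "h x\<^sub>1") (auto simp: dom_conjugate_def)
    have "- ereal s \<le> (INF x. (SUP u\<in>U. F u (x, 0)) - ereal (pairing a x))"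
    proof (rule INF_greatest)
      fix x
      have "ereal (pairing a x - s) \<le> h x"
        using s conjugate_le_iff[of h a s] by simp
      also have "\<dots> \<le> (SUP u\<in>U. F u (x, 0))"
        using A by (simp add: statement_A_def)
      finally show "- ereal s \<le> (SUP u\<in>U. F u (x, 0)) - ereal (pairing a x)"
        by (cases "SUP u\<in>U. F u (x, 0)") auto
    qed
    then have INF_G: "- ereal s \<le> (INF x. G x - ereal (pairing a x))"
        "(INF x. G x - ereal (pairing a x)) \<noteq> \<infinity>"
      using assms(4) a by (auto simp: G_def)
    have minorant: "ereal (pairing a y - s) \<le> G y" for y
    proof -
      have "- ereal s \<le> G y - ereal (pairing a y)"
        using INF_G(1) by (rule order_trans) (rule INF_lower, simp)
      then show ?thesis
        by (cases "G y") auto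
    qed
    \<comment> \<open>If \<open>G\<close> were infinite everywhere, so would be the infimum that is
      assumed to differ from infinity.\<close>
    have "\<exists>x. G x \<noteq> \<infinity>"
    proof (rule ccontr)
      assume "\<nexists>x. G x \<noteq> \<infinity>"
      then show False
        using INF_G(2) by (simp add: top_ereal_def)
    qed
    then obtain x\<^sub>0 where "G x\<^sub>0 \<noteq> \<infinity>"
      by blast
    with minorant have "(a, s) \<in> closure (convex hull F_sharp U F)"
      unfolding G_def by (rule in_closure_F_sharp)
    moreover have "(a, s) \<in> gph_conjugate h"
      using a s by (simp add: gph_conjugate_def)
    ultimately have "(a, s) \<in> F_sharp U F"
      using assms(5) unfolding closed_convex_regarding_def by blast
    then show "\<exists>u\<in>U. \<exists>\<mu>. conjugate2 (F u) (a, \<mu>) \<le> conjugate h a"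
      by (simp add: F_sharp_def s)
  qed
  then show ?thesis
    using statement_B_imp_A[OF assms(1-3)] by (auto simp: S_procedure_valid_def)
qed

end
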